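(* Let $n\in\mathbb N_0$, $\alpha,\beta\in(-1,\infty)$, $0<|q|<1$, $|t|<(1-q^{\alpha+1})(1-q)$. Then $$\int_0^\infty{}_0\phi_1\!\left(-;q^{\alpha+1};q,-xtq^{\alpha+1}\right)L_n^{(\beta)}(x;q)\frac{x^\beta}{(-x;q)_\infty}\,dx=\frac{-\left(tq^{\alpha-\beta}\right)^n(t;q)_\infty}{q^n(q^{\alpha+1};q)_n}\;{}_2\phi_1\!\left(q^{\alpha-\beta},0;q^{\alpha+n+1};q,t\right)\,M_n(\beta),$$ where $$M_n(\beta)=\begin{cases}\dfrac{\pi(q^{-\beta};q)_\infty(q^{\beta+1};q)_n}{\sin(\pi\beta)(q;q)_\infty(q;q)_n},&\beta\in(-1,\infty)\setminus\mathbb N_0,\\[3mm]\dfrac{(q^{n+1};q)_\beta\log q}{q^{\beta(\beta+1)/2}},&\beta\in\mathbb N_0.\end{cases}$$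
   Context: Notation: $\mathbb N_0=\{0,1,2,\dots\}$, $(a;q)_0=1$, $(a;q)_n=\prod_{j=0}^{n-1}(1-aq^j)$, $(a;q)_\infty=\prod_{j\ge0}(1-aq^j)$, $(a_1,\dots,a_r;q)_n=\prod_i(a_i;q)_n$. The basic hypergeometric series, with upper parameters listed before the first semicolon and lower parameters before the second (a dash denotes an empty list), is $${}_r\phi_s(a_1,\dots,a_r;b_1,\dots,b_s;q,z)=\sum_{k=0}^\infty\frac{(a_1,\dots,a_r;q)_k}{(q,b_1,\dots,b_s;q)_k}\left((-1)^kq^{\binom k2}\right)^{1+s-r}z^k.$$ The $q$-Laguerre polynomials are $$L_n^{(\alpha)}(x;q)=\frac{(q^{\alpha+1};q)_n}{(q;q)_n}\,{}_1\phi_1\!\left(q^{-n};q^{\alpha+1};q,-q^{n+\alpha+1}x\right).$$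
   Formalization: The condition 0<|q|<1 is replaced by 0<q<1: for negative q the weight 1/(-x;q)_∞ has poles on the path of integration (e.g. q=-1/2, x=2), and for non-real q the bound on |t| is not meaningful in general and the formula fails. *)

theory Defs
  imports "HOL-Analysis.Analysis"
begin

definition qpoch :: "'a::comm_ring_1 \<Rightarrow> 'a \<Rightarrow> nat \<Rightarrow> 'a" where
  "qpoch a q n = (\<Prod>j<n. 1 - a * q ^ j)"

(* The library's infinite product has value 0 when finitely many factors vanish,
   which is the intended value here. *)
definition qpoch_inf :: "'a::real_normed_field \<Rightarrow> 'a \<Rightarrow> 'a" where
  "qpoch_inf a q = (\<Prod>j. 1 - a * q ^ j)"

(* The first list holds the r upper parameters, the second the s lower ones. The exponent
   1 + s - r is an integer that may be negative, hence "powi". *)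
definition basic_hypergeometric ::
    "'a::real_normed_field list \<Rightarrow> 'a list \<Rightarrow> 'a \<Rightarrow> 'a \<Rightarrow> 'a" where
  "basic_hypergeometric as bs q z =
     (\<Sum>k. (\<Prod>a\<leftarrow>as. qpoch a q k) / (\<Prod>b\<leftarrow>q # bs. qpoch b q k)
          * ((-1) ^ k * q ^ (k choose 2)) powi (1 + int (length bs) - int (length as))
          * z ^ k)"

definition qlaguerre :: "nat \<Rightarrow> real \<Rightarrow> real \<Rightarrow> real \<Rightarrow> real" where
  "qlaguerre n \<alpha> x q =
     qpoch (q powr (\<alpha> + 1)) q n / qpoch q q n
     * basic_hypergeometric [q powi (- int n)] [q powr (\<alpha> + 1)] q
         (- (q powr (real n + \<alpha> + 1)) * x)"

definition qlaguerre_M :: "real \<Rightarrow> nat \<Rightarrow> real \<Rightarrow> real" where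
  "qlaguerre_M q n \<beta> =
     (if \<beta> \<in> \<nat>
      then qpoch (q ^ (n + 1)) q (nat \<lfloor>\<beta>\<rfloor>) * ln q / q powr (\<beta> * (\<beta> + 1) / 2)
      else pi * qpoch_inf (q powr (- \<beta>)) q * qpoch (q powr (\<beta> + 1)) q n
           / (sin (pi * \<beta>) * qpoch_inf q q * qpoch q q n))"

end

theory Submission
  imports Defs
begin

text \<open>
  Write \<open>w(x) = 1 / (-x;q)\<^sub>\<infinity>\<close> and \<open>b = q powr (\<beta> + 1)\<close>. Everything rests on the moments
  \<open>\<mu>\<^sub>k = \<integral> x powr (\<beta> + k) * w(x) dx\<close> over the positive half-line. Since \<open>w(q x) = (1 + x) w(x)\<close>, scaling
  the integration variable gives \<open>\<mu>\<^sub>k\<^sub>+\<^sub>1 = (1 / (b q^k) - 1) \<mu>\<^sub>k\<close>, so only \<open>\<mu>\<^sub>0\<close> for \<open>-1 < \<beta> \<le> 0\<close> has to be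
  computed. This is Ramanujan's integral, and it follows from a second functional equation: with
  \<open>w\<^sub>n(x) = 1 / (-x;q)\<^sub>n\<close> one has \<open>w\<^sub>n(x) - q^n w\<^sub>n(q x) = (1 - q^n) w\<^sub>n\<^sub>+\<^sub>1(x)\<close>, so the Mellin transform
  of \<open>w\<^sub>n\<^sub>+\<^sub>1\<close> is an explicit multiple of that of \<open>w\<^sub>n\<close>. One starts from \<open>w\<^sub>1\<close>, where the transform is
  \<open>pi / sin (pi c)\<close> by the reflection formula for the Gamma function, and lets \<open>n\<close> tend to infinity. For
  \<open>\<beta> = 0\<close> the function \<open>w\<^sub>1\<close> is not integrable and one starts from \<open>w\<^sub>2\<close> instead; this is where the
  logarithm in the case of integral \<open>\<beta>\<close> comes from. The results are \<open>has_mellin_ramanujan\<close> and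
  \<open>has_mellin_moments\<close>.

  The coefficients of the entire function under the integral decay like \<open>q^(k^2)\<close>, whereas the moments
  grow only like \<open>q^(-k^2/2)\<close>; so one may integrate term by term. The integral of \<open>x^k\<close> against the
  \<open>q\<close>-Laguerre polynomial of degree \<open>n\<close> is a terminating sum which the \<open>q\<close>-Chu--Vandermonde formula
  evaluates to a multiple of \<open>(q^(-k);q)\<^sub>n\<close>; it vanishes for \<open>k < n\<close>, which is the orthogonality of
  the polynomials. Shifting \<open>k\<close> by \<open>n\<close> leaves a constant times a \<open>1\<phi>1\<close> series in \<open>t\<close>, and a limiting case
  of Heine's transformation, \<open>heine_limit\<close>, turns this into \<open>(t;q)\<^sub>\<infinity>\<close> times the \<open>2\<phi>1\<close> series of the claim.
  That transformation is again Chu--Vandermonde, now read as a Cauchy product with Euler's series for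
  \<open>1 / (t;q)\<^sub>\<infinity>\<close>.
\<close>

section \<open>Shifted factorials\<close>

lemma qpoch_0 [simp]: "qpoch a q 0 = 1"
  by (simp add: qpoch_def)

lemma qpoch_Suc: "qpoch a q (Suc n) = qpoch a q n * (1 - a * q ^ n)"
  by (simp add: qpoch_def)

lemma qpoch_Suc_shift: "qpoch a q (Suc n) = (1 - a) * qpoch (a * q) q n"
  by (simp add: qpoch_def prod.lessThan_Suc_shift mult_ac del: prod.lessThan_Suc)

lemma qpoch_add: "qpoch a q (m + n) = qpoch a q m * qpoch (a * q ^ m) q n"
  by (induction n) (simp_all add: qpoch_Suc power_add mult_ac)

lemma qpoch_zero_left [simp]: "qpoch 0 q n = 1"
  by (simp add: qpoch_def)

lemma qpoch_of_real:
  "qpoch (of_real a :: 'a :: {real_algebra_1, comm_ring_1}) (of_real q) n = of_real (qpoch a q n)"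
  by (induction n) (simp_all add: qpoch_Suc)

lemma one_minus_mult_power_nonzero:
  fixes a q :: "'a :: real_normed_field"
  assumes "norm a < 1" "norm q < 1"
  shows "1 - a * q ^ j \<noteq> 0"
proof
  assume "1 - a * q ^ j = 0"
  then have "norm (a * q ^ j) = 1" by simp
  moreover have "norm (a * q ^ j) \<le> norm a * 1"
    unfolding norm_mult norm_power using assms by (intro mult_left_mono power_le_one) auto
  ultimately show False using assms by simp
qed

lemma qpoch_nonzero:
  fixes a q :: "'a :: real_normed_field"
  assumes "norm a < 1" "norm q < 1"
  shows "qpoch a q n \<noteq> 0"
  using one_minus_mult_power_nonzero[OF assms] by (simp add: qpoch_def)

lemma convergent_prod_qpoch:
  fixes a q :: "'a :: {real_normed_field, banach}"
  assumes "norm q < 1"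
  shows "convergent_prod (\<lambda>j. 1 - a * q ^ j)"
proof (intro abs_convergent_prod_imp_convergent_prod summable_imp_abs_convergent_prod)
  show "summable (\<lambda>j. norm (1 - a * q ^ j - 1))"
    using assms by (simp add: norm_mult norm_power summable_mult summable_geometric)
qed

lemma qpoch_LIMSEQ:
  fixes a q :: "'a :: {real_normed_field, banach}"
  assumes "norm q < 1"
  shows "(\<lambda>n. qpoch a q n) \<longlonglongrightarrow> qpoch_inf a q"
  using convergent_prod_LIMSEQ[OF convergent_prod_qpoch[OF assms, of a]]
  unfolding qpoch_def qpoch_inf_def lessThan_Suc_atMost[symmetric]
  by (rule LIMSEQ_imp_Suc)

lemma qpoch_inf_shift:
  fixes a q :: "'a :: {real_normed_field, banach}"
  assumes "norm q < 1"
  shows "qpoch_inf a q = (1 - a) * qpoch_inf (a * q) q"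
proof (rule LIMSEQ_unique)
  show "(\<lambda>n. qpoch a q (Suc n)) \<longlonglongrightarrow> qpoch_inf a q"
    using qpoch_LIMSEQ[OF assms] by (rule LIMSEQ_Suc)
  show "(\<lambda>n. qpoch a q (Suc n)) \<longlonglongrightarrow> (1 - a) * qpoch_inf (a * q) q"
    unfolding qpoch_Suc_shift by (intro tendsto_intros qpoch_LIMSEQ assms)
qed

lemma qpoch_inf_nonzero:
  fixes a q :: "'a :: {real_normed_field, banach}"
  assumes "norm a < 1" "norm q < 1"
  shows "qpoch_inf a q \<noteq> 0"
  unfolding qpoch_inf_def
  using convergent_prod_qpoch[OF assms(2), of a] one_minus_mult_power_nonzero[OF assms]
  by (intro prodinf_nonzero) auto

lemma choose_two_Suc: "Suc n choose 2 = (n choose 2) + n"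
  by (simp add: numeral_2_eq_2)

lemma choose_two_add: "(m + n) choose 2 = (m choose 2) + (n choose 2) + m * n"
  by (induction n) (simp_all add: choose_two_Suc)

lemma square_eq_choose_two: "n * n = 2 * (n choose 2) + n"
  by (induction n) (simp_all add: choose_two_Suc)

section \<open>The terminating Chu--Vandermonde sum\<close>

text \<open>
  This is \<open>(q^(-n);q)\<^sub>j q^(n j) / (q;q)\<^sub>j\<close>, that is, \<open>(-1)^j q^(j choose 2)\<close> times the Gaussian binomial
  coefficient. The product form needs no negative power of \<open>q\<close> and is defined, with value 0, for \<open>j > n\<close>,
  so that the recurrence below holds without side conditions on \<open>j\<close>.
\<close>

definition vandermonde_coeff :: "'a :: field \<Rightarrow> nat \<Rightarrow> nat \<Rightarrow> 'a" where
  "vandermonde_coeff q n j = (\<Prod>i<j. (q ^ n - q ^ i) / (1 - q ^ Suc i))"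

lemma vandermonde_coeff_0 [simp]: "vandermonde_coeff q n 0 = 1"
  by (simp add: vandermonde_coeff_def)

lemma vandermonde_coeff_Suc:
  "vandermonde_coeff q n (Suc j) = vandermonde_coeff q n j * ((q ^ n - q ^ j) / (1 - q ^ Suc j))"
  by (simp add: vandermonde_coeff_def)

lemma vandermonde_coeff_eq_0: "n < j \<Longrightarrow> vandermonde_coeff q n j = 0"
  by (auto simp: vandermonde_coeff_def)

lemma vandermonde_coeff_pascal:
  assumes q: "\<And>j. 1 - q ^ Suc j \<noteq> 0"
  shows "vandermonde_coeff q (Suc n) (Suc j) =
           q ^ Suc j * vandermonde_coeff q n (Suc j) - q ^ j * vandermonde_coeff q n j"
proof -
  have shift: "vandermonde_coeff q (Suc n) (Suc j) =
                 vandermonde_coeff q n j * (q ^ j * ((q ^ Suc n - 1) / (1 - q ^ Suc j)))"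
  proof (induction j)
    case 0
    show ?case by (simp add: vandermonde_coeff_Suc)
  next
    case (Suc j)
    show ?case
      unfolding vandermonde_coeff_Suc[of q "Suc n" "Suc j"] Suc.IH vandermonde_coeff_Suc[of q n j]
      using q[of j] q[of "Suc j"] by (simp add: field_simps)
  qed
  show ?thesis
    unfolding shift vandermonde_coeff_Suc[of q n j]
    using q[of j] by (simp add: field_simps)
qed

lemma vandermonde_coeff_eq_qpoch_ratio:
  assumes q: "\<And>j. 1 - q ^ Suc j \<noteq> 0" and "j \<le> n"
  shows "vandermonde_coeff q n j =
           (-1) ^ j * q ^ (j choose 2) * (qpoch q q n / (qpoch q q j * qpoch q q (n - j)))"
  using \<open>j \<le> n\<close>
proof (induction j)
  case 0
  have "qpoch q q n \<noteq> 0" using q by (simp add: qpoch_def)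
  then show ?case by (simp add: binomial_eq_0)
next
  case (Suc j)
  then have *: "n - j = Suc (n - Suc j)" by simp
  have "q ^ n = q ^ j * q ^ (n - j)"
    using Suc.prems by (simp flip: power_add)
  then have n: "q ^ n - q ^ j = - (q ^ j) * (1 - q * q ^ (n - Suc j))"
    by (simp add: * algebra_simps)
  define u v where "u = 1 - q * q ^ (n - Suc j)" and "v = 1 - q ^ Suc j"
  have nz: "u \<noteq> 0" "v \<noteq> 0" "qpoch q q k \<noteq> 0" for k
    using q[of "n - Suc j"] q[of j] q by (simp_all add: u_def v_def qpoch_def)
  have qpoch_v: "qpoch q q (Suc j) = qpoch q q j * v"
    and qpoch_u: "qpoch q q (n - j) = qpoch q q (n - Suc j) * u"
    by (simp_all add: * qpoch_Suc u_def v_def)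
  have IH: "vandermonde_coeff q n j =
      (-1) ^ j * q ^ (j choose 2) * (qpoch q q n / (qpoch q q j * qpoch q q (n - j)))"
    using Suc by simp
  show ?case
    unfolding vandermonde_coeff_Suc IH n qpoch_v qpoch_u u_def[symmetric] v_def[symmetric]
    using nz by (simp add: choose_two_Suc power_add field_simps)
qed

lemma vandermonde_coeff_eq_qpoch_inverse_power:
  assumes q: "\<And>j. 1 - q ^ Suc j \<noteq> 0" and "q \<noteq> 0"
  shows "vandermonde_coeff q n j * qpoch q q j = qpoch (inverse (q ^ n)) q j * q ^ (n * j)"
proof (induction j)
  case (Suc j)
  have "vandermonde_coeff q n (Suc j) * qpoch q q (Suc j) =
          (vandermonde_coeff q n j * qpoch q q j) * (q ^ n - q ^ j)"
    using q[of j] by (simp add: vandermonde_coeff_Suc qpoch_Suc field_simps)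
  also have "\<dots> = qpoch (inverse (q ^ n)) q (Suc j) * q ^ (n * Suc j)"
    unfolding Suc.IH using \<open>q \<noteq> 0\<close> by (simp add: qpoch_Suc power_add field_simps)
  finally show ?case .
qed simp

text \<open>
  By the Pascal recurrence and a summation by parts, the sum for \<open>n + 1\<close> becomes a sum weighted by the
  differences \<open>T\<^sub>j - T\<^sub>j\<^sub>+\<^sub>1\<close> of consecutive terms \<open>T\<^sub>j = (a)\<^sub>j z^j / (a z)\<^sub>j\<close>. In the numerator of such a difference
  the terms in \<open>q^j\<close> cancel and only \<open>1 - z\<close> is left, so the sum is \<open>(1 - z) / (1 - a z)\<close> times the one
  for \<open>n\<close> with \<open>z\<close> replaced by \<open>z q\<close>; hence the induction is over all \<open>z\<close>.
\<close>

theorem q_chu_vandermonde: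
  fixes q a z :: "'a :: field"
  assumes q: "\<And>j. 1 - q ^ Suc j \<noteq> 0" and "\<And>j. 1 - a * z * q ^ j \<noteq> 0"
  shows "(\<Sum>j\<le>n. vandermonde_coeff q n j * (qpoch a q j / qpoch (a * z) q j) * z ^ j) =
           qpoch z q n / qpoch (a * z) q n"
  using assms(2)
proof (induction n arbitrary: z)
  case 0
  show ?case by simp
next
  case (Suc n)
  let ?e = "vandermonde_coeff q" and ?T = "\<lambda>j. qpoch a q j / qpoch (a * z) q j * z ^ j"
  have nz: "qpoch (a * z) q j \<noteq> 0" for j
    using Suc.prems by (simp add: qpoch_def)
  have nz': "1 - a * (z * q) * q ^ j \<noteq> 0" for j
    using Suc.prems[of "Suc j"] by (simp add: mult_ac)
  have "(\<Sum>j\<le>Suc n. ?e (Suc n) j * ?T j) = 1 + (\<Sum>j\<le>n. ?e (Suc n) (Suc j) * ?T (Suc j))"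
    by (subst sum.atMost_Suc_shift) simp
  also have "\<dots> = 1 + (\<Sum>j\<le>n. q ^ Suc j * ?e n (Suc j) * ?T (Suc j))
                   - (\<Sum>j\<le>n. q ^ j * ?e n j * ?T (Suc j))"
    by (subst vandermonde_coeff_pascal[OF q]) (simp only: left_diff_distrib sum_subtractf add_diff_eq)
  also have "1 + (\<Sum>j\<le>n. q ^ Suc j * ?e n (Suc j) * ?T (Suc j)) = (\<Sum>j\<le>Suc n. q ^ j * ?e n j * ?T j)"
    by (subst sum.atMost_Suc_shift) simp
  also have "\<dots> = (\<Sum>j\<le>n. q ^ j * ?e n j * ?T j)"
    by (simp add: vandermonde_coeff_eq_0)
  also have "\<dots> - (\<Sum>j\<le>n. q ^ j * ?e n j * ?T (Suc j)) = (\<Sum>j\<le>n. q ^ j * ?e n j * (?T j - ?T (Suc j)))"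
    by (simp add: right_diff_distrib sum_subtractf)
  also have "\<dots> = (\<Sum>j\<le>n. (1 - z) / (1 - a * z) *
                    (?e n j * (qpoch a q j / qpoch (a * (z * q)) q j) * (z * q) ^ j))"
  proof (rule sum.cong [OF refl])
    fix j
    have "?T j - ?T (Suc j) = qpoch a q j * z ^ j * ((1 - z) / qpoch (a * z) q (Suc j))"
      using nz[of j] Suc.prems[of j] by (simp add: qpoch_Suc field_simps)
    then have diff: "?T j - ?T (Suc j) =
        qpoch a q j * z ^ j * ((1 - z) / ((1 - a * z) * qpoch (a * (z * q)) q j))"
      by (simp add: qpoch_Suc_shift[of "a * z"] mult.assoc)
    show "q ^ j * ?e n j * (?T j - ?T (Suc j)) = (1 - z) / (1 - a * z) *
                    (?e n j * (qpoch a q j / qpoch (a * (z * q)) q j) * (z * q) ^ j)"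
      unfolding diff by (simp add: power_mult_distrib)
  qed
  also have "\<dots> = (1 - z) / (1 - a * z) * (qpoch (z * q) q n / qpoch (a * (z * q)) q n)"
    unfolding sum_distrib_left[symmetric] using Suc.IH[of "z * q"] nz' by simp
  also have "\<dots> = qpoch z q (Suc n) / qpoch (a * z) q (Suc n)"
    by (simp add: qpoch_Suc_shift mult.assoc)
  finally show ?case by (simp only: mult.assoc)
qed

section \<open>Euler's series and a limiting case of Heine's transformation\<close>

text \<open>
  The ratio test, for series whose terms are given with an exact ratio: all hypergeometric series
  below have this form.
\<close>

lemma summable_norm_ratio_tendsto:
  fixes f r :: "nat \<Rightarrow> 'a :: real_normed_field"
  assumes f: "\<And>n. f (Suc n) = r n * f n" and r: "r \<longlonglongrightarrow> l" and "norm l < 1"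
  shows "summable (\<lambda>n. norm (f n))"
proof -
  obtain c where c: "norm l < c" "c < 1"
    using dense[OF \<open>norm l < 1\<close>] by blast
  have "\<forall>\<^sub>F n in sequentially. norm (r n) < c"
    using tendsto_norm[OF r] c(1) by (rule order_tendstoD)
  then obtain N where N: "\<And>n. n \<ge> N \<Longrightarrow> norm (r n) < c"
    by (auto simp: eventually_sequentially)
  show ?thesis
  proof (rule summable_ratio_test [OF c(2)])
    fix n assume "N \<le> n"
    then show "norm (norm (f (Suc n))) \<le> c * norm (norm (f n))"
      using N[of n] by (simp add: f norm_mult mult_right_mono)
  qed
qed

lemma summable_norm_euler:
  fixes q z :: "'a :: {real_normed_field, banach}"
  assumes q: "norm q < 1" and z: "norm z < 1"
  shows "summable (\<lambda>m. norm (z ^ m / qpoch q q m))"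
proof (rule summable_norm_ratio_tendsto)
  show "z ^ Suc m / qpoch q q (Suc m) = z / (1 - q * q ^ m) * (z ^ m / qpoch q q m)" for m
    by (simp add: qpoch_Suc)
  have "(\<lambda>m. z / (1 - q * q ^ m)) \<longlonglongrightarrow> z / (1 - q * 0)"
    by (intro tendsto_intros LIMSEQ_power_zero q) auto
  then show "(\<lambda>m. z / (1 - q * q ^ m)) \<longlonglongrightarrow> z" by simp
qed (fact z)

text \<open>
  The sum \<open>f\<close> of the series satisfies \<open>f(z q) = (1 - z) f(z)\<close>. Iterating this moves the argument to the
  origin, where \<open>f\<close> is continuous with value 1, and builds up the infinite product.
\<close>

lemma euler_sums:
  fixes q z :: "'a :: {real_normed_field, banach}"
  assumes q: "norm q < 1" and z: "norm z < 1"
  shows "(\<lambda>m. z ^ m / qpoch q q m) sums (1 / qpoch_inf z q)"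
proof -
  let ?c = "\<lambda>m. 1 / qpoch q q m"
  define f where "f z = (\<Sum>m. ?c m * z ^ m)" for z :: 'a
  have summ: "summable (\<lambda>m. ?c m * w ^ m)" if "norm w < 1" for w
    using summable_norm_cancel[OF summable_norm_euler[OF q that]] by simp
  have step: "f (w * q) = (1 - w) * f w" if w: "norm w < 1" for w
  proof -
    have wq: "norm (w * q) < 1"
      using mult_strict_mono'[of "norm w" 1 "norm q" 1] w q by (simp add: norm_mult)
    have "(\<lambda>m. ?c m * w ^ m - ?c m * (w * q) ^ m) sums (f w - f (w * q))"
      unfolding f_def by (intro sums_diff summable_sums summ w wq)
    then have "(\<lambda>m. ?c (Suc m) * w ^ Suc m - ?c (Suc m) * (w * q) ^ Suc m) sums (f w - f (w * q))"
      by (subst sums_Suc_iff) simp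
    also have "(\<lambda>m. ?c (Suc m) * w ^ Suc m - ?c (Suc m) * (w * q) ^ Suc m) = (\<lambda>m. w * (?c m * w ^ m))"
    proof
      fix m
      define u where "u = 1 - q * q ^ m"
      have "u \<noteq> 0" unfolding u_def by (rule one_minus_mult_power_nonzero[OF q q])
      have "?c (Suc m) * w ^ Suc m - ?c (Suc m) * (w * q) ^ Suc m = ?c (Suc m) * (w ^ Suc m * u)"
        by (simp add: u_def power_mult_distrib algebra_simps)
      also have "\<dots> = w * (?c m * w ^ m)"
        using \<open>u \<noteq> 0\<close> by (simp add: qpoch_Suc flip: u_def)
      finally show "?c (Suc m) * w ^ Suc m - ?c (Suc m) * (w * q) ^ Suc m = w * (?c m * w ^ m)" .
    qed
    finally have "f w - f (w * q) = w * f w"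
      using sums_unique2 sums_mult[OF summable_sums[OF summ[OF w]], of w] by (auto simp: f_def)
    then show ?thesis by (simp add: algebra_simps)
  qed
  have iter: "f (z * q ^ n) = qpoch z q n * f z" for n
  proof (induction n)
    case (Suc n)
    have "norm (z * q ^ n) < 1"
      using z q power_le_one[of "norm q" n] mult_left_le[of "norm q ^ n" "norm z"]
      by (simp add: norm_mult norm_power)
    from step[OF this] show ?case by (simp add: Suc qpoch_Suc mult_ac)
  qed simp
  have "isCont f 0"
    unfolding f_def
  proof -
    obtain K :: real where K: "0 < K" "K < 1" using dense[of 0 "1::real"] by auto
    show "isCont (\<lambda>z. \<Sum>m. ?c m * z ^ m) 0"
      by (rule isCont_powser[OF summ[of "of_real K"]]) (use K in auto)
  qed
  moreover have "(\<lambda>n. z * q ^ n) \<longlonglongrightarrow> 0"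
    using tendsto_mult[OF tendsto_const LIMSEQ_power_zero[OF q], of z] by simp
  ultimately have "(\<lambda>n. f (z * q ^ n)) \<longlonglongrightarrow> f 0"
    by (rule isCont_tendsto_compose)
  moreover have "(\<lambda>n. f (z * q ^ n)) \<longlonglongrightarrow> qpoch_inf z q * f z"
    unfolding iter by (intro tendsto_intros qpoch_LIMSEQ q)
  ultimately have "qpoch_inf z q * f z = f 0"
    by (metis LIMSEQ_unique)
  also have "f 0 = 1"
    unfolding f_def by (subst powser_zero) simp
  finally have "f z = 1 / qpoch_inf z q"
    using qpoch_inf_nonzero[OF z q] by (simp add: field_simps)
  then show ?thesis
    using summable_sums[OF summ[OF z]] by (simp add: f_def)
qed

text \<open>
  In terms of series, \<open>1\<phi>1(a; a b; q, b z) = (z;q)\<^sub>\<infinity> 2\<phi>1(b, 0; a b; q, z)\<close>. Chu--Vandermonde expands the quotient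
  \<open>(b)\<^sub>k / (a b)\<^sub>k\<close> into a sum over \<open>j \<le> k\<close> whose terms, divided by \<open>(q;q)\<^sub>k\<close>, factor into a function of \<open>j\<close> and
  \<open>1 / (q;q)\<^sub>k\<^sub>-\<^sub>j\<close>. So the \<open>2\<phi>1\<close> series is the Cauchy product of the \<open>1\<phi>1\<close> series with Euler's series.
\<close>

lemma heine_limit:
  fixes a b q z :: "'a :: {real_normed_field, banach}"
  assumes q: "norm q < 1" and z: "norm z < 1" and ab: "\<And>j. 1 - a * b * q ^ j \<noteq> 0"
  shows "(\<lambda>j. qpoch a q j / (qpoch q q j * qpoch (a * b) q j) * q ^ (j choose 2) * (- b * z) ^ j)
           sums (qpoch_inf z q * (\<Sum>k. qpoch b q k / (qpoch q q k * qpoch (a * b) q k) * z ^ k))"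
proof -
  let ?A = "\<lambda>j. qpoch a q j / (qpoch q q j * qpoch (a * b) q j) * q ^ (j choose 2) * (- b * z) ^ j"
  let ?B = "\<lambda>m. z ^ m / qpoch q q m"
  have q_nz: "1 - q ^ Suc j \<noteq> 0" for j
    using one_minus_mult_power_nonzero[OF q q, of j] by simp
  have summ: "summable (\<lambda>j. norm (?A j))"
  proof (rule summable_norm_ratio_tendsto)
    let ?r = "\<lambda>j. (1 - a * q ^ j) / ((1 - q * q ^ j) * (1 - a * b * q ^ j)) * (q ^ j * (- b * z))"
    show "?A (Suc j) = ?r j * ?A j" for j
      by (simp add: qpoch_Suc choose_two_Suc power_add mult_ac)
    have "?r \<longlonglongrightarrow> (1 - a * 0) / ((1 - q * 0) * (1 - a * b * 0)) * (0 * (- b * z))"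
      by (intro tendsto_intros LIMSEQ_power_zero q) auto
    then show "?r \<longlonglongrightarrow> 0" by simp
  qed simp
  have "(\<lambda>k. \<Sum>j\<le>k. ?A j * ?B (k - j)) sums ((\<Sum>j. ?A j) * (\<Sum>m. ?B m))"
    by (rule Cauchy_product_sums[OF summ summable_norm_euler[OF q z]])
  also have "(\<lambda>k. \<Sum>j\<le>k. ?A j * ?B (k - j)) =
               (\<lambda>k. qpoch b q k / (qpoch q q k * qpoch (a * b) q k) * z ^ k)"
  proof
    fix k
    have "(\<Sum>j\<le>k. ?A j * ?B (k - j)) =
            (\<Sum>j\<le>k. z ^ k / qpoch q q k * (vandermonde_coeff q k j * (qpoch a q j / qpoch (a * b) q j) * b ^ j))"
    proof (rule sum.cong [OF refl])
      fix j assume "j \<in> {..k}"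
      then have j: "j \<le> k" by simp
      then have "z ^ k = z ^ j * z ^ (k - j)" by (simp flip: power_add)
      then show "?A j * ?B (k - j) =
          z ^ k / qpoch q q k * (vandermonde_coeff q k j * (qpoch a q j / qpoch (a * b) q j) * b ^ j)"
        using qpoch_nonzero[OF q q, of k]
        by (simp add: vandermonde_coeff_eq_qpoch_ratio[OF q_nz j] power_minus[of "b * z"] power_mult_distrib mult_ac)
    qed
    also have "\<dots> = z ^ k / qpoch q q k * (qpoch b q k / qpoch (a * b) q k)"
      unfolding sum_distrib_left[symmetric] by (subst q_chu_vandermonde[OF q_nz ab]) simp
    finally show "(\<Sum>j\<le>k. ?A j * ?B (k - j)) = qpoch b q k / (qpoch q q k * qpoch (a * b) q k) * z ^ k"
      by simp
  qed
  finally have "(\<Sum>k. qpoch b q k / (qpoch q q k * qpoch (a * b) q k) * z ^ k) =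
                  (\<Sum>j. ?A j) * (\<Sum>m. ?B m)"
    by (simp add: sums_iff)
  also have "(\<Sum>m. ?B m) = 1 / qpoch_inf z q"
    using euler_sums[OF q z] by (simp add: sums_iff)
  finally have "(\<Sum>j. ?A j) = qpoch_inf z q * (\<Sum>k. qpoch b q k / (qpoch q q k * qpoch (a * b) q k) * z ^ k)"
    using qpoch_inf_nonzero[OF z q] by simp
  with summable_sums[OF summable_norm_cancel[OF summ]] show ?thesis by simp
qed

section \<open>Mellin transforms\<close>

text \<open>
  The transform is encoded by an indicator function because \<open>powr\<close> takes meaningless values at negative
  arguments. The Bochner integral makes absolute convergence part of the notion, so that the
  convergence theorems apply.
\<close>

definition has_mellin :: "(real \<Rightarrow> real) \<Rightarrow> real \<Rightarrow> real \<Rightarrow> bool" where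
  "has_mellin f c v \<longleftrightarrow>
     has_bochner_integral lborel (\<lambda>x. indicator {0<..} x * (x powr (c - 1) * f x)) v"

lemma has_mellin_diff:
  "has_mellin f c u \<Longrightarrow> has_mellin g c v \<Longrightarrow> has_mellin (\<lambda>x. f x - g x) c (u - v)"
  unfolding has_mellin_def
  by (drule (1) has_bochner_integral_diff) (simp add: algebra_simps)

lemma has_mellin_cmult: "has_mellin f c v \<Longrightarrow> has_mellin (\<lambda>x. a * f x) c (a * v)"
  unfolding has_mellin_def mult.left_commute[of _ a] by (rule has_bochner_integral_mult_right)

lemma has_mellin_cong:
  assumes "\<And>x. x > 0 \<Longrightarrow> f x = g x" "u = v"
  shows "has_mellin f c u \<longleftrightarrow> has_mellin g c v"
  unfolding has_mellin_def using assms
  by (intro has_bochner_integral_cong) (auto simp: indicator_def)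

lemma has_mellin_times_x: "has_mellin (\<lambda>x. x * f x) c v \<longleftrightarrow> has_mellin f (c + 1) v"
  unfolding has_mellin_def
  by (intro has_bochner_integral_cong refl)
     (auto simp: indicator_def powr_mult_base mult_ac powr_diff)

lemma has_mellin_dilate:
  assumes f: "has_mellin f c v" and "a > 0"
  shows "has_mellin (\<lambda>x. f (a * x)) c (a powr (- c) * v)"
proof -
  let ?F = "\<lambda>x. indicator {0<..} x * (x powr (c - 1) * f x)"
  from f have "integrable lborel ?F" "integral\<^sup>L lborel ?F = v"
    by (auto simp: has_mellin_def has_bochner_integral_iff)
  then have "has_bochner_integral lborel (\<lambda>x. ?F (0 + a * x)) (v / a)"
    using \<open>a > 0\<close> lborel_integral_real_affine[of a ?F 0] lborel_integrable_real_affine[of ?F a 0]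
    by (simp add: has_bochner_integral_iff field_simps)
  from has_bochner_integral_mult_right[of "a powr (1 - c)", OF this]
  have "has_bochner_integral lborel (\<lambda>x. a powr (1 - c) * ?F (0 + a * x)) (a powr (1 - c) * (v / a))"
    by simp
  also have "(\<lambda>x. a powr (1 - c) * ?F (0 + a * x)) =
               (\<lambda>x. indicator {0<..} x * (x powr (c - 1) * f (a * x)))"
  proof
    fix x :: real
    have "a powr (1 - c) * (a powr (c - 1)) = 1"
      using \<open>a > 0\<close> by (simp flip: powr_add)
    then show "a powr (1 - c) * ?F (0 + a * x) = indicator {0<..} x * (x powr (c - 1) * f (a * x))"
      using \<open>a > 0\<close> by (auto simp: indicator_def powr_mult zero_less_mult_iff)
  qed
  also have "a powr (1 - c) * (v / a) = a powr (- c) * v"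
    using \<open>a > 0\<close> by (simp add: powr_diff powr_minus field_simps)
  finally show ?thesis by (simp add: has_mellin_def)
qed

lemma has_mellin_dominated_convergence:
  assumes f: "\<And>n. has_mellin (f n) c (v n)" and v: "v \<longlonglongrightarrow> u"
    and g: "has_mellin g c w"
    and bound: "\<And>n x. x > 0 \<Longrightarrow> \<bar>f n x\<bar> \<le> g x"
    and lim: "\<And>x. x > 0 \<Longrightarrow> (\<lambda>n. f n x) \<longlonglongrightarrow> h x"
  shows "has_mellin h c u"
proof -
  let ?I = "\<lambda>h x. indicator {0<..} x * (x powr (c - 1) * h x) :: real"
  have [measurable]: "?I (f n) \<in> borel_measurable lborel" for n
    using f[of n] by (auto simp: has_mellin_def has_bochner_integral_iff dest: borel_measurable_integrable)
  have lim': "(\<lambda>n. ?I (f n) x) \<longlonglongrightarrow> ?I h x" for x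
    by (cases "x > 0") (auto intro!: tendsto_intros lim)
  have [measurable]: "?I h \<in> borel_measurable lborel"
    by (rule borel_measurable_LIMSEQ_real[OF lim']) auto
  have g': "integrable lborel (?I g)"
    using g by (simp add: has_mellin_def has_bochner_integral_iff)
  have bound': "norm (?I (f n) x) \<le> ?I g x" for n x
    using bound[of x n] by (auto simp: indicator_def abs_mult intro!: mult_left_mono)
  have "integrable lborel (?I h)"
    by (rule integrable_dominated_convergence[where s = "\<lambda>n. ?I (f n)" and w = "?I g"])
       (use g' lim' bound' in auto)
  moreover have "(\<lambda>n. integral\<^sup>L lborel (?I (f n))) \<longlonglongrightarrow> integral\<^sup>L lborel (?I h)"
    by (rule integral_dominated_convergence[where w = "?I g"]) (use g' lim' bound' in auto)
  moreover have "(\<lambda>n. integral\<^sup>L lborel (?I (f n))) = v"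
    using f by (auto simp: has_mellin_def has_bochner_integral_iff)
  ultimately show ?thesis
    using v LIMSEQ_unique by (auto simp: has_mellin_def has_bochner_integral_iff)
qed

lemma has_mellin_of_has_integral:
  assumes [measurable]: "f \<in> borel_measurable borel" and nonneg: "\<And>x. x > 0 \<Longrightarrow> f x \<ge> 0"
    and int: "((\<lambda>x. x powr (c - 1) * f x) has_integral v) {0<..}"
  shows "has_mellin f c v"
proof -
  let ?I = "\<lambda>x. indicator {0<..} x * (x powr (c - 1) * f x)"
  have "?I = (\<lambda>x. if x \<in> {0<..} then x powr (c - 1) * f x else 0)"
    by (auto simp: fun_eq_iff)
  then have "(?I has_integral v) UNIV"
    using int by (simp only: has_integral_restrict_UNIV)
  moreover have nn: "?I x \<ge> 0" for x
    using nonneg by (auto simp: indicator_def)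
  ultimately have "integral\<^sup>N lborel ?I = v"
    by (intro nn_integral_has_integral_lborel) auto
  moreover have "v \<ge> 0"
    by (rule has_integral_nonneg[OF int]) (use nonneg in auto)
  ultimately show ?thesis
    unfolding has_mellin_def using nn by (intro has_bochner_integral_nn_integral) auto
qed

text \<open>
  The substitution \<open>t = x / (1 + x)\<close> turns the integral into the Beta integral at \<open>(c, 1 - c)\<close>, which the
  reflection formula evaluates.
\<close>

lemma has_mellin_inverse_one_plus:
  assumes c: "0 < c" "c < 1"
  shows "has_mellin (\<lambda>x. 1 / (1 + x)) c (pi / sin (pi * c))"
proof (rule has_mellin_of_has_integral)
  let ?b = "\<lambda>t :: real. t powr (c - 1) * (1 - t) powr ((1 - c) - 1)"
  let ?g = "\<lambda>x :: real. x / (1 + x)" and ?h = "\<lambda>x :: real. 1 / (1 + x) ^ 2"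
  have beta: "(?b has_integral Beta c (1 - c)) {0<..<1}"
    using has_integral_Beta_real[of c "1 - c"] c by (simp add: has_integral_Icc_iff_Ioo)
  have img: "?g ` {0<..} = {0<..<1}"
  proof (intro equalityI subsetI)
    fix t :: real assume "t \<in> {0<..<1}"
    then show "t \<in> ?g ` {0<..}"
      by (intro image_eqI[of _ _ "t / (1 - t)"]) (auto simp: field_simps)
  qed (auto simp: field_simps)
  have inj: "inj_on ?g {0<..}"
    by (auto simp: inj_on_def field_simps)
  have deriv: "(?g has_field_derivative ?h x) (at x within {0<..})" if "x \<in> {0<..}" for x
    using that by (auto intro!: derivative_eq_intros simp: field_simps power2_eq_square)
  have "?b absolutely_integrable_on {0<..<1}"
    using beta by (intro nonnegative_absolutely_integrable_1) (auto simp: integrable_on_def)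
  with beta have "(\<lambda>x. \<bar>?h x\<bar> * ?b (?g x)) absolutely_integrable_on {0<..} \<and>
      integral {0<..} (\<lambda>x. \<bar>?h x\<bar> * ?b (?g x)) = Beta c (1 - c)"
    by (subst has_absolute_integral_change_of_variables_1'[OF _ deriv inj])
       (auto simp: img integral_unique)
  then have "((\<lambda>x. \<bar>?h x\<bar> * ?b (?g x)) has_integral Beta c (1 - c)) {0<..}"
    unfolding has_integral_iff using set_lebesgue_integral_eq_integral(1) by blast
  also have "Beta c (1 - c) = pi / sin (pi * c)"
  proof -
    have "complex_of_real (Gamma c * Gamma (1 - c)) =
            Gamma (complex_of_real c) * Gamma (1 - complex_of_real c)"
      by (simp only: of_real_mult Gamma_complex_of_real[symmetric] of_real_diff of_real_1)
    also have "\<dots> = complex_of_real (pi / sin (pi * c))"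
      by (simp only: Gamma_reflection_complex of_real_divide sin_of_real[symmetric] of_real_mult)
    finally have "Gamma c * Gamma (1 - c) = pi / sin (pi * c)"
      by (simp only: of_real_eq_iff)
    then show ?thesis by (simp add: Beta_def)
  qed
  finally show "((\<lambda>x. x powr (c - 1) * (1 / (1 + x))) has_integral pi / sin (pi * c)) {0<..}"
  proof (rule has_integral_eq[rotated])
    fix x :: real assume "x \<in> {0<..}"
    then have x: "x > 0" by simp
    then have "1 - x / (1 + x) = 1 / (1 + x)" by (simp add: field_simps)
    then have "\<bar>?h x\<bar> * ?b (?g x) = x powr (c - 1) * ((1 + x) powr c * (1 + x) powr (1 - c)) / (1 + x) ^ 2"
      using x by (simp add: powr_divide powr_diff powr_minus field_simps)
    also have "(1 + x) powr c * (1 + x) powr (1 - c) = 1 + x"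
      using x by (simp flip: powr_add)
    finally show "\<bar>?h x\<bar> * ?b (?g x) = x powr (c - 1) * (1 / (1 + x))"
      using x by (simp add: power2_eq_square)
  qed
qed auto

section \<open>Ramanujan's integral\<close>

lemma qpoch_neg_ge_1:
  fixes q x :: real
  assumes "0 < q" "x > 0"
  shows "qpoch (- x) q n \<ge> 1"
  unfolding qpoch_def using assms by (intro prod_ge_1) simp

lemma qpoch_inf_neg_ge_1:
  fixes q x :: real
  assumes "0 < q" "q < 1" "x > 0"
  shows "qpoch_inf (- x) q \<ge> 1"
  by (rule LIMSEQ_le_const[OF qpoch_LIMSEQ]) (use assms qpoch_neg_ge_1 in auto)

text \<open>
  Peeling either the last or the first factor off \<open>(-x;q)\<^sub>n\<^sub>+\<^sub>1\<close> expresses \<open>1 / (-x;q)\<^sub>n\<close> and \<open>1 / (-q x;q)\<^sub>n\<close>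
  as \<open>1 + x q^n\<close> and \<open>1 + x\<close> times the next reciprocal. The combination taken in the proof eliminates \<open>x\<close>
  from these factors, so no transform at a shifted argument appears.
\<close>

lemma has_mellin_inverse_qpoch_Suc:
  assumes q: "0 < q" "q < 1" and "n > 0"
    and v: "has_mellin (\<lambda>x. 1 / qpoch (- x) q n) c v"
  shows "has_mellin (\<lambda>x. 1 / qpoch (- x) q (Suc n)) c
           (v * ((1 - q powr (- c) * q ^ n) / (1 - q ^ n)))"
proof -
  let ?f = "\<lambda>n x. 1 / qpoch (- x) q n"
  have "q ^ n < 1" using q \<open>n > 0\<close> by (simp add: power_less_one_iff)
  have "has_mellin (\<lambda>x. 1 / (1 - q ^ n) * (?f n x - q ^ n * ?f n (q * x))) c
          (1 / (1 - q ^ n) * (v - q ^ n * (q powr (- c) * v)))"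
    by (intro has_mellin_cmult has_mellin_diff v has_mellin_dilate q)
  also have "?this \<longleftrightarrow> ?thesis"
  proof (rule has_mellin_cong)
    fix x :: real assume x: "x > 0"
    define u where "u = qpoch (- x) q (Suc n)"
    have "u > 0" using qpoch_neg_ge_1[OF q(1) x, of "Suc n"] by (simp add: u_def)
    have pos: "1 + x * q ^ n > 0" "1 + x > 0" using x q by (simp_all add: add_pos_pos)
    have "u = qpoch (- x) q n * (1 + x * q ^ n)"
      by (simp add: u_def qpoch_Suc)
    then have f1: "?f n x = (1 + x * q ^ n) / u"
      using pos by simp
    have "u = (1 + x) * qpoch (- (q * x)) q n"
      by (simp add: u_def qpoch_Suc_shift mult.commute)
    then have f2: "?f n (q * x) = (1 + x) / u"
      using pos by simp
    have "?f n x - q ^ n * ?f n (q * x) = ((1 + x * q ^ n) - q ^ n * (1 + x)) / u"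
      unfolding f1 f2 by (simp add: diff_divide_distrib)
    also have "(1 + x * q ^ n) - q ^ n * (1 + x) = 1 - q ^ n"
      by (simp add: algebra_simps)
    finally show "1 / (1 - q ^ n) * (?f n x - q ^ n * ?f n (q * x)) = ?f (Suc n) x"
      using \<open>q ^ n < 1\<close> by (simp add: u_def)
  qed (simp add: algebra_simps diff_divide_distrib)
  finally show ?thesis .
qed

text \<open>
  The reciprocals decrease with the number of factors, so the first one dominates all of them. The start
  \<open>m\<close> is left open since the reciprocal of one factor has no transform at \<open>c = 1\<close>.
\<close>

lemma has_mellin_inverse_qpoch_inf:
  assumes q: "0 < q" "q < 1" and m: "m > 0"
    and v: "has_mellin (\<lambda>x. 1 / qpoch (- x) q m) c v"
  shows "has_mellin (\<lambda>x. 1 / qpoch_inf (- x) q) c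
           (v * (qpoch_inf (q powr (- c) * q ^ m) q / qpoch_inf (q ^ m) q))"
proof (rule has_mellin_dominated_convergence)
  show "has_mellin (\<lambda>x. 1 / qpoch (- x) q (m + n)) c
          (v * (qpoch (q powr (- c) * q ^ m) q n / qpoch (q ^ m) q n))" for n
  proof (induction n)
    case (Suc n)
    from has_mellin_inverse_qpoch_Suc[OF q _ Suc.IH] m show ?case
      by (simp add: qpoch_Suc power_add mult_ac)
  qed (use v in simp)
  have "q ^ m < 1" using q m by (simp add: power_less_one_iff)
  then show "(\<lambda>n. v * (qpoch (q powr (- c) * q ^ m) q n / qpoch (q ^ m) q n)) \<longlonglongrightarrow>
          v * (qpoch_inf (q powr (- c) * q ^ m) q / qpoch_inf (q ^ m) q)"
    using q by (intro tendsto_intros qpoch_LIMSEQ qpoch_inf_nonzero) auto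
  show "has_mellin (\<lambda>x. 1 / qpoch (- x) q m) c v" by (fact v)
next
  fix n and x :: real assume x: "x > 0"
  have "qpoch (- x) q (m + n) = qpoch (- x) q m * qpoch (- (x * q ^ m)) q n"
    by (simp add: qpoch_add)
  moreover have "qpoch (- (x * q ^ m)) q n \<ge> 1" "qpoch (- x) q m \<ge> 1"
    using x q by (auto intro!: qpoch_neg_ge_1)
  ultimately have "qpoch (- x) q m \<le> qpoch (- x) q (m + n)"
    using mult_left_mono[of 1 "qpoch (- (x * q ^ m)) q n" "qpoch (- x) q m"] by simp
  then show "\<bar>1 / qpoch (- x) q (m + n)\<bar> \<le> 1 / qpoch (- x) q m"
    using \<open>qpoch (- x) q m \<ge> 1\<close> by (simp add: frac_le)
  have "(\<lambda>n. 1 / qpoch (- x) q n) \<longlonglongrightarrow> 1 / qpoch_inf (- x) q"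
    using q qpoch_inf_neg_ge_1[OF q x] by (intro tendsto_intros qpoch_LIMSEQ) auto
  then show "(\<lambda>n. 1 / qpoch (- x) q (m + n)) \<longlonglongrightarrow> 1 / qpoch_inf (- x) q"
    by (subst add.commute) (rule LIMSEQ_ignore_initial_segment)
qed

text \<open>
  An elementary antiderivative exists here: partial fractions give
  \<open>(ln (1 + x) - ln (1 + q x)) / (1 - q)\<close>, which tends to \<open>- ln q / (1 - q)\<close>.
\<close>

lemma has_mellin_inverse_qpoch_2:
  assumes q: "0 < q" "q < 1"
  shows "has_mellin (\<lambda>x. 1 / qpoch (- x) q 2) 1 (- ln q / (1 - q))"
proof -
  let ?F = "\<lambda>x. (ln (1 + x) - ln (1 + q * x)) / (1 - q)"
  let ?f = "\<lambda>x. 1 / qpoch (- x) q 2"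
  have two: "qpoch (- x) q 2 = (1 + x) * (1 + q * x)" for x
    by (simp add: numeral_2_eq_2 qpoch_Suc mult.commute)
  have "(\<integral>\<^sup>+x. ennreal (?f x) * indicator {0..} x \<partial>lborel) = - ln q / (1 - q) - ?F 0"
  proof (rule nn_integral_FTC_atLeast)
    fix x :: real assume x: "0 \<le> x"
    then have pos: "1 + x > 0" "1 + q * x > 0" using q by (auto intro: add_pos_nonneg)
    then show "(?F has_real_derivative ?f x) (at x)"
      unfolding two using q by (auto intro!: derivative_eq_intros simp: divide_simps) (simp add: algebra_simps)
    show "0 \<le> ?f x"
      unfolding two using pos by simp
  next
    have "filterlim (\<lambda>x. 1 + q * x) at_top at_top"
      using q by (intro filterlim_tendsto_add_at_top[OF tendsto_const]
                    filterlim_tendsto_pos_mult_at_top[OF tendsto_const] filterlim_ident)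
    then have "((\<lambda>x. 1 / q + (1 - 1 / q) / (1 + q * x)) \<longlongrightarrow> 1 / q + 0) at_top"
      by (intro tendsto_add tendsto_const tendsto_divide_0[OF tendsto_const]
            filterlim_at_top_imp_at_infinity)
    then have "((\<lambda>x. (1 + x) / (1 + q * x)) \<longlongrightarrow> 1 / q) at_top"
    proof (rule Lim_transform_eventually[THEN tendsto_eq_rhs])
      show "\<forall>\<^sub>F x in at_top. 1 / q + (1 - 1 / q) / (1 + q * x) = (1 + x) / (1 + q * x)"
        using eventually_gt_at_top[of 0]
      proof eventually_elim
        case (elim x)
        define d where "d = 1 + q * x"
        then have "d > 0" using elim q by (simp add: add_pos_pos)
        have x: "1 + x = (d + q - 1) / q" using q by (simp add: d_def field_simps)
        show ?case unfolding d_def[symmetric] x using \<open>d > 0\<close> q by (simp add: field_simps)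
      qed
    qed simp
    then have "((\<lambda>x. ln ((1 + x) / (1 + q * x))) \<longlongrightarrow> ln (1 / q)) at_top"
      using q by (intro tendsto_ln) auto
    then have "((\<lambda>x. (ln ((1 + x) / (1 + q * x))) / (1 - q)) \<longlongrightarrow> ln (1 / q) / (1 - q)) at_top"
      using q by (intro tendsto_divide tendsto_const) auto
    also have "ln (1 / q) = - ln q" using q by (simp add: ln_div)
    finally show "(?F \<longlongrightarrow> - ln q / (1 - q)) at_top"
    proof (rule Lim_transform_eventually)
      show "\<forall>\<^sub>F x in at_top. ln ((1 + x) / (1 + q * x)) / (1 - q) = ?F x"
        using eventually_gt_at_top[of 0]
      proof eventually_elim
        case (elim x)
        then have "1 + x > 0" "1 + q * x > 0" using q by (auto intro: add_pos_pos)
        then show ?case by (simp add: ln_div)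
      qed
    qed
  qed (simp add: two)
  moreover have "(\<integral>\<^sup>+x. ennreal (?f x) * indicator {0..} x \<partial>lborel) =
               (\<integral>\<^sup>+x. ennreal (indicator {0<..} x * (x powr (1 - 1) * ?f x)) \<partial>lborel)"
    by (intro nn_integral_cong_AE AE_I[where N = "{0}"]) (auto simp: indicator_def)
  moreover have "ln q / (1 - q) \<le> 0"
    using q by (simp add: divide_nonpos_pos)
  ultimately show ?thesis
    unfolding has_mellin_def using q
    by (intro has_bochner_integral_nn_integral)
       (auto simp: two indicator_def intro!: add_nonneg_nonneg mult_nonneg_nonneg divide_nonneg_nonneg)
qed

text \<open>
  From \<open>w(q x) - w(x) = x w(x)\<close> for \<open>w(x) = 1 / (-x;q)\<^sub>\<infinity>\<close>.
\<close>

lemma has_mellin_inverse_qpoch_inf_step: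
  assumes q: "0 < q" "q < 1" and v: "has_mellin (\<lambda>x. 1 / qpoch_inf (- x) q) c v"
  shows "has_mellin (\<lambda>x. 1 / qpoch_inf (- x) q) (c + 1) ((q powr (- c) - 1) * v)"
proof -
  let ?f = "\<lambda>x. 1 / qpoch_inf (- x) q"
  have "has_mellin (\<lambda>x. ?f (q * x) - ?f x) c (q powr (- c) * v - v)"
    by (intro has_mellin_diff has_mellin_dilate v q)
  also have "?this \<longleftrightarrow> has_mellin (\<lambda>x. x * ?f x) c ((q powr (- c) - 1) * v)"
  proof (rule has_mellin_cong)
    fix x :: real assume x: "x > 0"
    have "qpoch_inf (- x) q = (1 + x) * qpoch_inf (- (q * x)) q"
      using qpoch_inf_shift[of q "- x"] q by (simp add: mult.commute)
    moreover have "qpoch_inf (- (q * x)) q \<ge> 1"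
      using x q by (intro qpoch_inf_neg_ge_1) auto
    ultimately have "?f (q * x) = (1 + x) * ?f x"
      using x by simp
    then show "?f (q * x) - ?f x = x * ?f x"
      by (simp add: distrib_right add_divide_distrib)
  qed (simp add: algebra_simps)
  finally show ?thesis by (simp only: has_mellin_times_x)
qed

lemma add_one_in_Nats_iff:
  fixes \<beta> :: real
  assumes "\<beta> > -1"
  shows "\<beta> + 1 \<in> \<nat> \<longleftrightarrow> \<beta> \<in> \<nat>"
proof
  assume "\<beta> + 1 \<in> \<nat>"
  then obtain n where n: "\<beta> + 1 = real n" by (auto elim: Nats_cases)
  with assms have "n > 0" by (cases n) auto
  with n have "\<beta> = real (n - 1)" by simp
  then show "\<beta> \<in> \<nat>" by simp
qed auto

lemma qlaguerre_M_0_step: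
  assumes q: "0 < q" "q < 1" and \<beta>: "\<beta> > -1"
  shows "qlaguerre_M q 0 (\<beta> + 1) = (q powr (- (\<beta> + 1)) - 1) * qlaguerre_M q 0 \<beta>"
proof (cases "\<beta> \<in> \<nat>")
  case True
  then obtain N where N: "\<beta> = real N" by (auto elim: Nats_cases)
  have "(\<beta> + 1) * (\<beta> + 1 + 1) / 2 = \<beta> * (\<beta> + 1) / 2 + (\<beta> + 1)"
    by (simp add: field_simps)
  then have "q powr ((\<beta> + 1) * (\<beta> + 1 + 1) / 2) = q powr (\<beta> * (\<beta> + 1) / 2) * q powr (\<beta> + 1)"
    by (simp only: powr_add)
  moreover have "nat \<lfloor>\<beta> + 1\<rfloor> = Suc N" "nat \<lfloor>\<beta>\<rfloor> = N"
    by (simp_all add: N nat_add_distrib)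
  moreover have "\<beta> + 1 \<in> \<nat>" using True by simp
  moreover have pw: "q powr (\<beta> + 1) = q * q ^ N"
    using q by (simp add: N powr_add powr_realpow)
  moreover have "q powr (- (\<beta> + 1)) = 1 / (q * q ^ N)"
    by (simp only: powr_minus pw inverse_eq_divide)
  ultimately show ?thesis
    using True q by (simp add: qlaguerre_M_def qpoch_Suc field_simps)
next
  case False
  then have "\<beta> + 1 \<notin> \<nat>" using add_one_in_Nats_iff[OF \<beta>] by simp
  moreover have "qpoch_inf (q powr (- (\<beta> + 1))) q = (1 - q powr (- (\<beta> + 1))) * qpoch_inf (q powr (- \<beta>)) q"
    using qpoch_inf_shift[of q "q powr (- (\<beta> + 1))"] q by (simp add: powr_diff powr_minus)
  moreover have "sin (pi * (\<beta> + 1)) = - sin (pi * \<beta>)"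
    by (simp add: distrib_left)
  ultimately show ?thesis
    using False by (simp add: qlaguerre_M_def left_diff_distrib right_diff_distrib diff_divide_distrib mult_ac)
qed

text \<open>
  Both sides satisfy the same first-order recurrence in \<open>\<beta>\<close>, so it suffices to treat \<open>-1 < \<beta> \<le> 0\<close>. There
  the value is a limit of transforms of finite products, started with one factor for \<open>\<beta> < 0\<close> and with two
  factors for \<open>\<beta> = 0\<close>.
\<close>

theorem has_mellin_ramanujan:
  assumes q: "0 < q" "q < 1" and \<beta>: "\<beta> > -1"
  shows "has_mellin (\<lambda>x. 1 / qpoch_inf (- x) q) (\<beta> + 1) (- qlaguerre_M q 0 \<beta>)"
proof -
  have "has_mellin (\<lambda>x. 1 / qpoch_inf (- x) q) (\<beta> + 1) (- qlaguerre_M q 0 \<beta>)"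
    if "real m - 1 < \<beta>" "\<beta> \<le> real m" for m \<beta>
    using that
  proof (induction m arbitrary: \<beta>)
    case 0
    show ?case
    proof (cases "\<beta> = 0")
      case True
      have "q powr - 1 * q ^ 2 = q" using q by (simp add: powr_minus power2_eq_square)
      then have "has_mellin (\<lambda>x. 1 / qpoch_inf (- x) q) 1
                   (- ln q / (1 - q) * (qpoch_inf q q / qpoch_inf (q ^ 2) q))"
        using has_mellin_inverse_qpoch_inf[OF q _ has_mellin_inverse_qpoch_2[OF q]] by simp
      also have "qpoch_inf q q = (1 - q) * qpoch_inf (q ^ 2) q"
        using qpoch_inf_shift[of q q] q by (simp add: power2_eq_square)
      also have "- ln q / (1 - q) * ((1 - q) * qpoch_inf (q ^ 2) q / qpoch_inf (q ^ 2) q) = - ln q"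
        using q qpoch_inf_nonzero[of "q ^ 2" q] by (simp add: power_less_one_iff)
      finally show ?thesis using True q by (simp add: qlaguerre_M_def)
    next
      case False
      with 0 have \<beta>: "0 < \<beta> + 1" "\<beta> + 1 < 1" by auto
      then have "\<beta> \<notin> \<nat>" by (auto elim!: Nats_cases)
      have "has_mellin (\<lambda>x. 1 / qpoch (- x) q 1) (\<beta> + 1) (pi / sin (pi * (\<beta> + 1)))"
        using has_mellin_inverse_one_plus[OF \<beta>] by (simp add: qpoch_def)
      from has_mellin_inverse_qpoch_inf[OF q _ this]
      have "has_mellin (\<lambda>x. 1 / qpoch_inf (- x) q) (\<beta> + 1)
              (pi / sin (pi * (\<beta> + 1)) * (qpoch_inf (q powr (- (\<beta> + 1)) * q) q / qpoch_inf q q))"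
        by simp
      also have "q powr (- (\<beta> + 1)) * q = q powr (- \<beta>)"
        using q by (simp add: powr_diff powr_minus)
      also have "sin (pi * (\<beta> + 1)) = - sin (pi * \<beta>)"
        by (simp add: distrib_left)
      finally show ?thesis
        using \<open>\<beta> \<notin> \<nat>\<close> by (simp add: qlaguerre_M_def)
    qed
  next
    case (Suc m)
    then have "has_mellin (\<lambda>x. 1 / qpoch_inf (- x) q) (\<beta> - 1 + 1) (- qlaguerre_M q 0 (\<beta> - 1))"
      by (intro Suc.IH) auto
    from has_mellin_inverse_qpoch_inf_step[OF q this]
    show ?case
      using qlaguerre_M_0_step[OF q, of "\<beta> - 1"] Suc.prems by simp
  qed
  moreover have "real (nat \<lceil>\<beta>\<rceil>) - 1 < \<beta>" "\<beta> \<le> real (nat \<lceil>\<beta>\<rceil>)"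
    using \<beta> by linarith+
  ultimately show ?thesis by blast
qed

text \<open>
  This links the constant of the theorem to the zeroth moment, uniformly in both cases of its definition.
\<close>

lemma qlaguerre_M_eq:
  "qlaguerre_M q n \<beta> = qlaguerre_M q 0 \<beta> * (qpoch (q powr (\<beta> + 1)) q n / qpoch q q n)"
  if q: "0 < q" "q < 1"
proof (cases "\<beta> \<in> \<nat>")
  case True
  then obtain N where N: "\<beta> = real N" by (auto elim: Nats_cases)
  have "qpoch q q n * qpoch (q ^ (n + 1)) q N = qpoch q q (n + N)"
    by (simp add: qpoch_add)
  also have "\<dots> = qpoch q q N * qpoch (q powr (\<beta> + 1)) q n"
    using q by (subst add.commute) (simp add: qpoch_add N powr_add powr_realpow mult.commute)
  finally have "qpoch (q ^ (n + 1)) q N = qpoch q q N * qpoch (q powr (\<beta> + 1)) q n / qpoch q q n"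
    using qpoch_nonzero[of q q n] q by (simp add: field_simps)
  then show ?thesis
    using True by (simp add: qlaguerre_M_def N mult_ac)
qed (simp add: qlaguerre_M_def)

lemma has_mellin_moments:
  assumes q: "0 < q" "q < 1" and \<beta>: "\<beta> > -1"
  defines "b \<equiv> q powr (\<beta> + 1)"
  shows "has_mellin (\<lambda>x. 1 / qpoch_inf (- x) q) (\<beta> + 1 + real k)
           (- qlaguerre_M q 0 \<beta> * (qpoch b q k / (b ^ k * q ^ (k choose 2))))"
proof (induction k)
  case 0
  show ?case using has_mellin_ramanujan[OF q \<beta>] by (simp add: binomial_eq_0)
next
  case (Suc k)
  have "b > 0" using q by (simp add: b_def)
  have "q powr (- (\<beta> + 1 + real k)) = 1 / (b * q ^ k)"
    unfolding powr_minus powr_add[of q "\<beta> + 1"] b_def[symmetric] using q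
    by (simp add: powr_realpow inverse_eq_divide)
  then have "(q powr (- (\<beta> + 1 + real k)) - 1) *
               (- qlaguerre_M q 0 \<beta> * (qpoch b q k / (b ^ k * q ^ (k choose 2)))) =
             - qlaguerre_M q 0 \<beta> * (qpoch b q (Suc k) / (b ^ Suc k * q ^ (Suc k choose 2)))"
    using q \<open>b > 0\<close> by (simp add: qpoch_Suc choose_two_Suc power_add field_simps)
  with has_mellin_inverse_qpoch_inf_step[OF q Suc.IH] show ?case
    by (simp add: add_ac)
qed

section \<open>Termwise integration\<close>

text \<open>
  Since \<open>w\<close> is nonnegative, the integral of the norm of the \<open>k\<close>-th term is exactly \<open>norm (a k) * \<mu> k\<close>; so the
  absolute convergence of the integrated series is what dominated convergence asks for.
\<close>

lemma has_bochner_integral_power_series_mellin: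
  fixes a :: "nat \<Rightarrow> complex" and w :: "real \<Rightarrow> real"
  assumes w: "\<And>k. has_mellin w (c + real k) (\<mu> k)" and nonneg: "\<And>x. x > 0 \<Longrightarrow> w x \<ge> 0"
    and ptw: "\<And>x :: real. x > 0 \<Longrightarrow> summable (\<lambda>k. norm (a k * of_real x ^ k))"
    and summ: "summable (\<lambda>k. norm (a k * of_real (\<mu> k)))"
  shows "has_bochner_integral lborel
           (\<lambda>x. indicator {0<..} x *\<^sub>R ((\<Sum>k. a k * of_real x ^ k) * of_real (x powr (c - 1) * w x)))
           (\<Sum>k. a k * of_real (\<mu> k))"
proof -
  define g where "g k x = indicator {0<..} x * (x powr (c + real k - 1) * w x)" for k and x :: real
  let ?f = "\<lambda>k x. a k * complex_of_real (g k x)"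
  have g: "has_bochner_integral lborel (g k) (\<mu> k)" for k
    using w[of k] by (simp add: has_mellin_def g_def[abs_def])
  have g_nonneg: "g k x \<ge> 0" for k x
    using nonneg[of x] by (simp add: g_def indicator_def)
  then have \<mu>_nonneg: "\<mu> k \<ge> 0" for k
    using g[of k] Bochner_Integration.integral_nonneg[of lborel "g k"]
    by (simp add: has_bochner_integral_iff)
  have f: "has_bochner_integral lborel (?f k) (a k * of_real (\<mu> k))" for k
    by (intro has_bochner_integral_mult_right has_bochner_integral_of_real g)
  have f_norm: "has_bochner_integral lborel (\<lambda>x. norm (?f k x)) (norm (a k * of_real (\<mu> k)))" for k
    using has_bochner_integral_mult_right[OF g, of "norm (a k)" k] g_nonneg \<mu>_nonneg
    by (simp add: norm_mult)
  have g_eq: "g k x = indicator {0<..} x * (x ^ k * (x powr (c - 1) * w x))" for k x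
  proof (cases "x > 0")
    case True
    have "x powr (c + real k - 1) = x powr (c - 1 + real k)" by (simp add: algebra_simps)
    also have "\<dots> = x powr (c - 1) * x ^ k" using True by (simp add: powr_add powr_realpow)
    finally show ?thesis by (simp add: g_def)
  qed (simp add: g_def)
  have f_eq: "?f k x = a k * of_real x ^ k * of_real (indicator {0<..} x * (x powr (c - 1) * w x))" for k x
    by (simp add: g_eq mult_ac)
  have pw: "summable (\<lambda>k. norm (?f k x))" for x
  proof (cases "x > 0")
    case True
    from summable_mult2[OF ptw[OF True]] show ?thesis
      unfolding f_eq norm_mult[of "_ * _" "of_real _"] .
  qed (simp add: g_def)
  have f_int: "integrable lborel (?f k)" for k
    using f[of k] by (simp only: has_bochner_integral_iff)
  have f_norm_eq: "integral\<^sup>L lborel (\<lambda>x. norm (?f k x)) = norm (a k * of_real (\<mu> k))" for k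
    using f_norm[of k] by (simp only: has_bochner_integral_iff)
  have "integrable lborel (\<lambda>x. \<Sum>k. ?f k x)"
    by (intro integrable_suminf f_int AE_I2 pw) (unfold f_norm_eq, fact summ)
  moreover have "integral\<^sup>L lborel (\<lambda>x. \<Sum>k. ?f k x) = (\<Sum>k. integral\<^sup>L lborel (?f k))"
    by (intro integral_suminf f_int AE_I2 pw) (unfold f_norm_eq, fact summ)
  moreover have "(\<Sum>k. integral\<^sup>L lborel (?f k)) = (\<Sum>k. a k * of_real (\<mu> k))"
    using f by (simp only: has_bochner_integral_iff)
  moreover have "(\<Sum>k. ?f k x) =
      indicator {0<..} x *\<^sub>R ((\<Sum>k. a k * of_real x ^ k) * of_real (x powr (c - 1) * w x))" for x
  proof (cases "x > 0")
    case True
    then show ?thesis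
      unfolding f_eq using suminf_mult2[OF summable_norm_cancel[OF ptw[OF True]]] by simp
  qed (simp add: g_def)
  ultimately show ?thesis
    by (simp add: has_bochner_integral_iff)
qed

section \<open>The \<open>q\<close>-Laguerre polynomials and the generating function\<close>

text \<open>
  Here \<open>b\<close> stands for \<open>q powr (\<beta> + 1)\<close>.
\<close>

definition qlaguerre_coeff :: "'a :: field \<Rightarrow> 'a \<Rightarrow> nat \<Rightarrow> nat \<Rightarrow> 'a" where
  "qlaguerre_coeff q b n j = qpoch b q n / qpoch q q n
     * (vandermonde_coeff q n j * q ^ (j choose 2) * b ^ j / qpoch b q j)"

lemma qlaguerre_eq_sum:
  assumes q: "0 < q" "q < 1" and \<beta>: "\<beta> > -1"
  shows "qlaguerre n \<beta> x q = (\<Sum>j\<le>n. qlaguerre_coeff q (q powr (\<beta> + 1)) n j * x ^ j)"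
proof -
  define b where "b = q powr (\<beta> + 1)"
  have q_nz: "1 - q ^ Suc j \<noteq> 0" for j
    using one_minus_mult_power_nonzero[of q q j] q by simp
  have qq: "qpoch q q j \<noteq> 0" for j
    using qpoch_nonzero[of q q j] q by simp
  have pw: "q powr (real n + \<beta> + 1) = q ^ n * b"
    using q by (simp add: b_def powr_add powr_realpow)
  have "basic_hypergeometric [q powi (- int n)] [b] q (- (q powr (real n + \<beta> + 1)) * x) =
        (\<Sum>j. vandermonde_coeff q n j * q ^ (j choose 2) * b ^ j / qpoch b q j * x ^ j)"
    unfolding basic_hypergeometric_def
  proof (rule arg_cong[where f = suminf], rule ext)
    fix j
    have "qpoch (q powi (- int n)) q j = vandermonde_coeff q n j * qpoch q q j / q ^ (n * j)"
      using vandermonde_coeff_eq_qpoch_inverse_power[OF q_nz, of n j] q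
      by (simp add: power_int_minus field_simps)
    moreover have "- (q powr (real n + \<beta> + 1)) * x = -1 * (q ^ n * (b * x))"
      unfolding pw by simp
    then have "(- (q powr (real n + \<beta> + 1)) * x) ^ j = (-1) ^ j * (q ^ (n * j) * (b ^ j * x ^ j))"
      by (simp only: power_mult_distrib power_mult)
    moreover have "(-1 :: real) ^ j * (-1) ^ j = 1"
      by (simp flip: power_mult_distrib)
    ultimately show "(\<Prod>a\<leftarrow>[q powi (- int n)]. qpoch a q j) / (\<Prod>b\<leftarrow>q # [b]. qpoch b q j)
          * ((-1) ^ j * q ^ (j choose 2)) powi (1 + int (length [b]) - int (length [q powi (- int n)]))
          * (- (q powr (real n + \<beta> + 1)) * x) ^ j =
        vandermonde_coeff q n j * q ^ (j choose 2) * b ^ j / qpoch b q j * x ^ j"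
      using q qq[of j] by simp
  qed
  also have "\<dots> = (\<Sum>j\<le>n. vandermonde_coeff q n j * q ^ (j choose 2) * b ^ j / qpoch b q j * x ^ j)"
    by (rule suminf_finite) (auto simp: vandermonde_coeff_eq_0)
  finally show ?thesis
    unfolding qlaguerre_def b_def[symmetric]
    by (simp add: qlaguerre_coeff_def sum_distrib_left mult_ac)
qed

text \<open>
  Up to the factor \<open>\<mu>\<^sub>0\<close>, this is the integral of \<open>x^k\<close> against the polynomial of degree \<open>n\<close> and the weight. The
  powers of \<open>q\<close> in the coefficients and in the moments combine to \<open>q^(-k j)\<close>, so the sum is
  Chu--Vandermonde with \<open>a = b q^k\<close> and \<open>z = q^(-k)\<close>. The factor \<open>vandermonde_coeff q k n\<close> vanishes for
  \<open>k < n\<close>: this is orthogonality.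
\<close>

lemma sum_qlaguerre_coeff_moments:
  fixes q b :: "'a :: field"
  assumes q: "q \<noteq> 0" "\<And>j. 1 - q ^ Suc j \<noteq> 0" and b: "b \<noteq> 0" "\<And>j. 1 - b * q ^ j \<noteq> 0"
  shows "(\<Sum>j\<le>n. qlaguerre_coeff q b n j * (qpoch b q (k + j) / (b ^ (k + j) * q ^ ((k + j) choose 2)))) =
           qpoch b q k / (b ^ k * q ^ (k choose 2)) * (vandermonde_coeff q k n / q ^ (k * n))"
proof -
  let ?K = "qpoch b q n / qpoch q q n * (qpoch b q k / (b ^ k * q ^ (k choose 2)))"
  have nz: "qpoch q q j \<noteq> 0" "qpoch b q j \<noteq> 0" for j
    using q b by (simp_all add: qpoch_def)
  have z: "b * q ^ k * inverse (q ^ k) = b" using q by simp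
  have "(\<Sum>j\<le>n. qlaguerre_coeff q b n j * (qpoch b q (k + j) / (b ^ (k + j) * q ^ ((k + j) choose 2)))) =
        (\<Sum>j\<le>n. ?K * (vandermonde_coeff q n j * (qpoch (b * q ^ k) q j / qpoch b q j) * inverse (q ^ k) ^ j))"
    unfolding qlaguerre_coeff_def qpoch_add choose_two_add power_add power_mult[of q k] power_inverse
    using q b nz by (intro sum.cong refl) (simp add: field_simps)
  also have "\<dots> = ?K * (qpoch (inverse (q ^ k)) q n / qpoch b q n)"
    unfolding sum_distrib_left[symmetric]
    using q_chu_vandermonde[OF q(2), of "b * q ^ k" "inverse (q ^ k)" n] b(2) unfolding z by simp
  also have "qpoch (inverse (q ^ k)) q n = vandermonde_coeff q k n * qpoch q q n / q ^ (k * n)"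
    using vandermonde_coeff_eq_qpoch_inverse_power[OF q(2) q(1), of k n] q(1) by (simp add: field_simps)
  finally show ?thesis using nz by simp
qed

text \<open>
  The left-hand side is the \<open>(m + n)\<close>-th coefficient of the generating series times the corresponding
  integral, with \<open>q powr (\<alpha> + 1) = d * b\<close> and the factor \<open>\<mu>\<^sub>0\<close> removed. The right-hand side is a constant
  times the \<open>m\<close>-th term of the series in \<open>heine_limit\<close>, whose parameters \<open>a\<close> and \<open>b\<close> are here
  \<open>b * q ^ n\<close> and \<open>d\<close>.
\<close>

lemma integrated_term_eq_heine_term:
  fixes q b d t :: "'a :: field"
  assumes q: "q \<noteq> 0" "\<And>j. 1 - q ^ Suc j \<noteq> 0" and b: "b \<noteq> 0"
  shows "(q ^ (m + n choose 2))\<^sup>2 * (- (t * (d * b))) ^ (m + n) / (qpoch q q (m + n) * qpoch (d * b) q (m + n))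
           * (qpoch b q (m + n) / (b ^ (m + n) * q ^ (m + n choose 2))
              * (vandermonde_coeff q (m + n) n / q ^ ((m + n) * n))) =
         (t * d) ^ n * qpoch b q n / (q ^ n * qpoch q q n * qpoch (d * b) q n)
           * (qpoch (b * q ^ n) q m / (qpoch q q m * qpoch (b * q ^ n * d) q m)
              * q ^ (m choose 2) * (- d * t) ^ m)"
proof -
  have nz: "qpoch q q j \<noteq> 0" for j
    using q by (simp add: qpoch_def)
  have split: "qpoch a q (m + n) = qpoch a q n * qpoch (a * q ^ n) q m" for a
    by (subst add.commute) (rule qpoch_add)
  have v: "vandermonde_coeff q (m + n) n = (-1) ^ n * q ^ (n choose 2) * (qpoch q q (m + n) / (qpoch q q n * qpoch q q m))"
    using vandermonde_coeff_eq_qpoch_ratio[OF q(2), of n "m + n"] by simp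
  have "(q ^ (n choose 2) * q ^ (n choose 2)) * q ^ n = q ^ (n * n)"
    unfolding square_eq_choose_two by (simp add: power_add mult_2)
  then have pw: "q ^ (m + n choose 2) * q ^ (n choose 2) / q ^ ((m + n) * n) = q ^ (m choose 2) / q ^ n"
    using q by (simp add: choose_two_add power_add add_mult_distrib field_simps)
  have "- (t * (d * b)) = (- d * t) * b" "- d * t = (-1) * (t * d)" by simp_all
  then have "(- (t * (d * b))) ^ (m + n) = (- d * t) ^ m * ((-1) * (t * d)) ^ n * b ^ (m + n)"
    by (simp only: power_add power_mult_distrib mult_ac)
  then have "(- (t * (d * b))) ^ (m + n) = (- d * t) ^ m * (-1) ^ n * (t * d) ^ n * b ^ (m + n)"
    by (simp only: power_mult_distrib mult.assoc)
  moreover have "(-1 :: 'a) ^ n * (-1) ^ n = 1"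
    by (simp flip: power_mult_distrib)
  ultimately have sgn: "(- (t * (d * b))) ^ (m + n) * (-1) ^ n / b ^ (m + n) = (- d * t) ^ m * (t * d) ^ n"
    using b by simp
  have "(q ^ (m + n choose 2))\<^sup>2 * (- (t * (d * b))) ^ (m + n) / (qpoch q q (m + n) * qpoch (d * b) q (m + n))
           * (qpoch b q (m + n) / (b ^ (m + n) * q ^ (m + n choose 2))
              * (vandermonde_coeff q (m + n) n / q ^ ((m + n) * n))) =
        ((- (t * (d * b))) ^ (m + n) * (-1) ^ n / b ^ (m + n))
        * (q ^ (m + n choose 2) * q ^ (n choose 2) / q ^ ((m + n) * n))
        * (qpoch b q (m + n) / (qpoch q q n * qpoch q q m * qpoch (d * b) q (m + n)))"
    unfolding v using nz[of "m + n"] q(1) by (simp add: power2_eq_square mult_ac)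
  also have "\<dots> = (- d * t) ^ m * (t * d) ^ n * (q ^ (m choose 2) / q ^ n)
        * (qpoch b q n * qpoch (b * q ^ n) q m /
           (qpoch q q n * qpoch q q m * (qpoch (d * b) q n * qpoch (b * q ^ n * d) q m)))"
    unfolding sgn pw split by (simp add: mult_ac)
  finally show ?thesis by (simp add: mult_ac)
qed

lemma summable_norm_generating_term:
  fixes q A z :: "'a :: {real_normed_field, banach}"
  assumes q: "norm q < 1"
  shows "summable (\<lambda>k. norm ((q ^ (k choose 2))\<^sup>2 * z ^ k / (qpoch q q k * qpoch A q k)))"
proof (rule summable_norm_ratio_tendsto)
  let ?r = "\<lambda>k. (q ^ k)\<^sup>2 * z / ((1 - q * q ^ k) * (1 - A * q ^ k))"
  show "(q ^ (Suc k choose 2))\<^sup>2 * z ^ Suc k / (qpoch q q (Suc k) * qpoch A q (Suc k)) =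
          ?r k * ((q ^ (k choose 2))\<^sup>2 * z ^ k / (qpoch q q k * qpoch A q k))" for k
    by (simp add: qpoch_Suc choose_two_Suc power_add power_mult_distrib mult_ac)
  have "?r \<longlonglongrightarrow> 0\<^sup>2 * z / ((1 - q * 0) * (1 - A * 0))"
    by (intro tendsto_intros LIMSEQ_power_zero q) auto
  then show "?r \<longlonglongrightarrow> 0" by simp
qed simp

text \<open>
  The square of \<open>q^(k choose 2)\<close> in the coefficient outweighs the single such power in the denominator of
  the moment: the ratio of consecutive terms is of order \<open>q^k\<close>.
\<close>

lemma summable_norm_generating_term_moments:
  fixes q A b z :: "'a :: {real_normed_field, banach}"
  assumes q: "norm q < 1" "q \<noteq> 0" and b: "b \<noteq> 0"
  shows "summable (\<lambda>k. norm ((q ^ (k choose 2))\<^sup>2 * z ^ k / (qpoch q q k * qpoch A q k)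
           * (qpoch b q (k + j) / (b ^ (k + j) * q ^ ((k + j) choose 2)))))"
proof (rule summable_norm_ratio_tendsto)
  let ?r = "\<lambda>k. q ^ k * z / ((1 - q * q ^ k) * (1 - A * q ^ k)) * ((1 - b * (q ^ k * q ^ j)) / (b * q ^ j))"
  show "(q ^ (Suc k choose 2))\<^sup>2 * z ^ Suc k / (qpoch q q (Suc k) * qpoch A q (Suc k))
           * (qpoch b q (Suc k + j) / (b ^ (Suc k + j) * q ^ ((Suc k + j) choose 2))) =
          ?r k * ((q ^ (k choose 2))\<^sup>2 * z ^ k / (qpoch q q k * qpoch A q k)
           * (qpoch b q (k + j) / (b ^ (k + j) * q ^ ((k + j) choose 2))))" for k
    using q(2) b
    by (simp add: qpoch_Suc choose_two_Suc power_add power_mult_distrib power2_eq_square mult_ac)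
  have "?r \<longlonglongrightarrow> 0 * z / ((1 - q * 0) * (1 - A * 0)) * ((1 - b * (0 * q ^ j)) / (b * q ^ j))"
    by (intro tendsto_intros LIMSEQ_power_zero q) (use q b in auto)
  then show "?r \<longlonglongrightarrow> 0" by simp
qed simp

lemma basic_hypergeometric_0_1:
  "basic_hypergeometric [] [A] q z = (\<Sum>k. (q ^ (k choose 2))\<^sup>2 * z ^ k / (qpoch q q k * qpoch A q k))"
proof -
  have "((-1) ^ k * q ^ (k choose 2)) powi 2 = (q ^ (k choose 2))\<^sup>2" for k
    by (simp add: power_mult_distrib flip: power_mult)
  then show ?thesis by (simp add: basic_hypergeometric_def)
qed

lemma basic_hypergeometric_2_1_zero:
  "basic_hypergeometric [a, 0] [c] q z = (\<Sum>k. qpoch a q k / (qpoch q q k * qpoch c q k) * z ^ k)"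
  by (simp add: basic_hypergeometric_def)

lemma has_integral_of_has_bochner_integral:
  fixes f :: "real \<Rightarrow> 'b :: euclidean_space"
  assumes "has_bochner_integral lborel (\<lambda>x. indicator S x *\<^sub>R f x) v"
  shows "(f has_integral v) S"
proof -
  have "((\<lambda>x. indicator S x *\<^sub>R f x) has_integral v) UNIV"
    using has_integral_integral_lborel[of "\<lambda>x. indicator S x *\<^sub>R f x"] assms
    by (simp only: has_bochner_integral_iff)
  then show ?thesis
    by (simp only: indicator_scaleR_eq_if has_integral_restrict_UNIV)
qed

theorem corollary25:
  fixes n :: nat and \<alpha> \<beta> q :: real and t :: complex
  assumes "\<alpha> > -1" and "\<beta> > -1"
    and "0 < q" and "q < 1"
    and "norm t < (1 - q powr (\<alpha> + 1)) * (1 - q)"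
  shows
    "((\<lambda>x::real.
         basic_hypergeometric [] [complex_of_real (q powr (\<alpha> + 1))] (complex_of_real q)
           (- complex_of_real x * t * complex_of_real (q powr (\<alpha> + 1)))
         * complex_of_real (qlaguerre n \<beta> x q)
         * complex_of_real (x powr \<beta> / qpoch_inf (- x) q))
      has_integral
        (- ((t * complex_of_real (q powr (\<alpha> - \<beta>))) ^ n) * qpoch_inf t (complex_of_real q)
         / complex_of_real (q ^ n * qpoch (q powr (\<alpha> + 1)) q n)
         * basic_hypergeometric [complex_of_real (q powr (\<alpha> - \<beta>)), 0]
             [complex_of_real (q powr (\<alpha> + real n + 1))] (complex_of_real q) t
         * complex_of_real (qlaguerre_M q n \<beta>)))
      {0<..}"
proof -
  note q = \<open>0 < q\<close> \<open>q < 1\<close>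
  define b d \<mu>\<^sub>0 where "b = q powr (\<beta> + 1)" and "d = q powr (\<alpha> - \<beta>)" and "\<mu>\<^sub>0 = - qlaguerre_M q 0 \<beta>"
  define \<mu> where "\<mu> k = \<mu>\<^sub>0 * (qpoch b q k / (b ^ k * q ^ (k choose 2)))" for k
  let ?Q = "complex_of_real q" and ?B = "complex_of_real b" and ?D = "complex_of_real d"
  define a where "a k = (?Q ^ (k choose 2))\<^sup>2 * (- (t * (?D * ?B))) ^ k / (qpoch ?Q ?Q k * qpoch (?D * ?B) ?Q k)" for k
  define l where "l = qlaguerre_coeff q b n"

  have A: "q powr (\<alpha> + 1) = d * b"
    by (simp add: b_def d_def flip: powr_add)
  have An: "q powr (\<alpha> + real n + 1) = b * q ^ n * d"
  proof -
    have "\<alpha> + real n + 1 = (\<beta> + 1) + real n + (\<alpha> - \<beta>)" by simp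
    then show ?thesis
      using q by (simp only: b_def d_def powr_add powr_realpow)
  qed
  have b: "0 < b" "b < 1" and ab: "0 < d * b" "d * b < 1"
    using q assms(1,2) powr01_less_one[OF q]
    unfolding A[symmetric] by (simp_all add: b_def)
  \<comment> \<open>The bound on \<open>t\<close> enters through Euler's series, which converges for \<open>norm t < 1\<close>.\<close>
  have t: "norm t < 1"
  proof -
    have "(1 - d * b) * (1 - q) \<le> 1 * 1"
      using ab q by (intro mult_mono) auto
    with assms(5) show ?thesis unfolding A by simp
  qed
  have Q: "norm ?Q < 1" "?Q \<noteq> 0" and B: "?B \<noteq> 0" "norm ?B < 1" using q b by auto
  have q_nz: "1 - q ^ Suc j \<noteq> 0" "1 - ?Q ^ Suc j \<noteq> 0" "1 - b * q ^ j \<noteq> 0" for j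
    using one_minus_mult_power_nonzero[of q q j] one_minus_mult_power_nonzero[OF Q(1) Q(1), of j]
      one_minus_mult_power_nonzero[of b q j] q b by simp_all

  have mellin: "has_mellin (\<lambda>x. 1 / qpoch_inf (- x) q) (\<beta> + 1 + real k) (\<mu> k)" for k
    using has_mellin_moments[OF q assms(2), of k] by (simp add: \<mu>_def \<mu>\<^sub>0_def b_def)
  have \<mu>_complex: "of_real (\<mu> k) = of_real \<mu>\<^sub>0 * (qpoch ?B ?Q k / (?B ^ k * ?Q ^ (k choose 2)))" for k
    by (simp add: \<mu>_def qpoch_of_real)
  have summ: "summable (\<lambda>k. norm (a k * of_real (\<mu> (k + j))))" for j
    unfolding a_def \<mu>_complex mult.left_commute[of _ "complex_of_real \<mu>\<^sub>0"]
      norm_mult[of "complex_of_real \<mu>\<^sub>0"]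
    by (intro summable_mult summable_norm_generating_term_moments Q B)
  have summ_x: "summable (\<lambda>k. norm (a k * of_real x ^ k))" for x :: real
    using summable_norm_generating_term[OF Q(1), of "- (t * (?D * ?B)) * of_real x" "?D * ?B"]
    unfolding power_mult_distrib by (simp add: a_def mult_ac)

  \<comment> \<open>The polynomial is split into monomials \<open>x ^ j\<close>, absorbed into the exponent of the Mellin transform;
     each is integrated against the series separately.\<close>
  let ?f = "\<lambda>j x. indicator {0<..} x *\<^sub>R ((\<Sum>k. a k * of_real x ^ k)
               * complex_of_real (x powr (\<beta> + 1 + real j - 1) * (1 / qpoch_inf (- x) q)))"
  have "has_bochner_integral lborel (?f j) (\<Sum>k. a k * of_real (\<mu> (k + j)))" for j
  proof (rule has_bochner_integral_power_series_mellin)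
    show "has_mellin (\<lambda>x. 1 / qpoch_inf (- x) q) (\<beta> + 1 + real j + real k) (\<mu> (k + j))" for k
      using mellin[of "k + j"] by (simp add: add_ac)
    show "1 / qpoch_inf (- x) q \<ge> 0" if "x > 0" for x
      using qpoch_inf_neg_ge_1[OF q that] by simp
  qed (use summ summ_x in auto)
  then have "has_bochner_integral lborel (\<lambda>x. \<Sum>j\<le>n. of_real (l j) * ?f j x)
               (\<Sum>j\<le>n. of_real (l j) * (\<Sum>k. a k * of_real (\<mu> (k + j))))"
    by (intro has_bochner_integral_sum has_bochner_integral_mult_right)
  moreover have "(\<Sum>j\<le>n. of_real (l j) * ?f j x) = indicator {0<..} x *\<^sub>R
      (basic_hypergeometric [] [complex_of_real (q powr (\<alpha> + 1))] ?Q
           (- complex_of_real x * t * complex_of_real (q powr (\<alpha> + 1)))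
         * complex_of_real (qlaguerre n \<beta> x q)
         * complex_of_real (x powr \<beta> / qpoch_inf (- x) q))" for x
  proof (cases "x > 0")
    case True
    have "basic_hypergeometric [] [complex_of_real (q powr (\<alpha> + 1))] ?Q
           (- complex_of_real x * t * complex_of_real (q powr (\<alpha> + 1))) = (\<Sum>k. a k * of_real x ^ k)"
    proof -
      have "- complex_of_real x * t * of_real (d * b) = - (t * (?D * ?B)) * of_real x" by simp
      then show ?thesis
        unfolding A basic_hypergeometric_0_1 a_def by (simp only: power_mult_distrib of_real_mult) (simp add: mult_ac)
    qed
    moreover have "x powr (\<beta> + 1 + real j - 1) = x powr \<beta> * x ^ j" for j
      using True by (simp add: powr_add powr_realpow)
    ultimately show ?thesis
      using True
      by (simp add: qlaguerre_eq_sum[OF q assms(2)] l_def b_def sum_distrib_left sum_distrib_right mult_ac)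
  qed simp
  moreover have "(\<Sum>j\<le>n. of_real (l j) * (\<Sum>k. a k * of_real (\<mu> (k + j)))) =
      (- ((t * complex_of_real (q powr (\<alpha> - \<beta>))) ^ n) * qpoch_inf t ?Q
         / complex_of_real (q ^ n * qpoch (q powr (\<alpha> + 1)) q n)
         * basic_hypergeometric [complex_of_real (q powr (\<alpha> - \<beta>)), 0]
             [complex_of_real (q powr (\<alpha> + real n + 1))] ?Q t
         * complex_of_real (qlaguerre_M q n \<beta>))" (is "_ = ?rhs")
  proof -
    define g where "g k = a k * of_real (\<mu>\<^sub>0 * (qpoch b q k / (b ^ k * q ^ (k choose 2))
                       * (vandermonde_coeff q k n / q ^ (k * n))))" for k
    have inner: "(\<Sum>j\<le>n. l j * \<mu> (k + j)) = \<mu>\<^sub>0 * (qpoch b q k / (b ^ k * q ^ (k choose 2))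
                       * (vandermonde_coeff q k n / q ^ (k * n)))" for k
      unfolding \<mu>_def l_def mult.left_commute[of _ \<mu>\<^sub>0] sum_distrib_left[symmetric]
      using q b q_nz by (subst sum_qlaguerre_coeff_moments) auto
    have "(\<Sum>j\<le>n. of_real (l j) * (\<Sum>k. a k * of_real (\<mu> (k + j)))) =
          (\<Sum>k. \<Sum>j\<le>n. of_real (l j) * (a k * of_real (\<mu> (k + j))))"
      using summable_norm_cancel[OF summ]
      by (simp add: suminf_sum suminf_mult summable_mult)
    also have "\<dots> = (\<Sum>k. g k)"
      unfolding g_def inner[symmetric] by (simp add: sum_distrib_left mult_ac)
    finally have lhs: "(\<Sum>j\<le>n. of_real (l j) * (\<Sum>k. a k * of_real (\<mu> (k + j)))) = (\<Sum>k. g k)" .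

    let ?K = "of_real \<mu>\<^sub>0 * ((t * ?D) ^ n * qpoch ?B ?Q n / (?Q ^ n * qpoch ?Q ?Q n * qpoch (?D * ?B) ?Q n))"
    let ?S = "qpoch_inf t ?Q * basic_hypergeometric [?D, 0] [?B * ?Q ^ n * ?D] ?Q t"
    have v_complex: "of_real (vandermonde_coeff q k n) = vandermonde_coeff ?Q k n" for k
      by (simp add: vandermonde_coeff_def)
    have "(\<lambda>m. g (m + n)) = (\<lambda>m. ?K * (qpoch (?B * ?Q ^ n) ?Q m / (qpoch ?Q ?Q m * qpoch (?B * ?Q ^ n * ?D) ?Q m)
              * ?Q ^ (m choose 2) * (- ?D * t) ^ m))"
    proof
      fix m
      have "g (m + n) = of_real \<mu>\<^sub>0 * ((?Q ^ (m + n choose 2))\<^sup>2 * (- (t * (?D * ?B))) ^ (m + n) /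
             (qpoch ?Q ?Q (m + n) * qpoch (?D * ?B) ?Q (m + n))
             * (qpoch ?B ?Q (m + n) / (?B ^ (m + n) * ?Q ^ (m + n choose 2))
              * (vandermonde_coeff ?Q (m + n) n / ?Q ^ ((m + n) * n))))"
        by (simp only: g_def a_def of_real_mult of_real_divide of_real_power v_complex
              qpoch_of_real[symmetric] mult.left_commute[of "complex_of_real \<mu>\<^sub>0"])
      then show "g (m + n) = ?K * (qpoch (?B * ?Q ^ n) ?Q m / (qpoch ?Q ?Q m * qpoch (?B * ?Q ^ n * ?D) ?Q m)
              * ?Q ^ (m choose 2) * (- ?D * t) ^ m)"
        unfolding integrated_term_eq_heine_term[OF Q(2) q_nz(2) B(1)] by (simp only: mult.assoc)
    qed
    moreover have "1 - ?B * ?Q ^ n * ?D * ?Q ^ j \<noteq> 0" for j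
      using one_minus_mult_power_nonzero[of "?D * ?B" ?Q "n + j"] Q ab
      by (simp add: power_add mult_ac norm_mult)
    ultimately have "(\<lambda>m. g (m + n)) sums (?K * ?S)"
      unfolding basic_hypergeometric_2_1_zero by (simp only:) (intro sums_mult heine_limit Q t)
    moreover have "g k = 0" if "k < n" for k
      using that by (simp add: g_def vandermonde_coeff_eq_0)
    ultimately have "g sums (?K * ?S)"
      by (simp add: sums_zero_iff_shift)
    then have "(\<Sum>k. g k) = ?K * ?S" by (rule sums_unique[symmetric])
    also have "?K * ?S = ?rhs"
    proof -
      have "of_real (qlaguerre_M q n \<beta>) = - of_real \<mu>\<^sub>0 * (qpoch ?B ?Q n / qpoch ?Q ?Q n)"
        unfolding qlaguerre_M_eq[OF q, of n] \<mu>\<^sub>0_def b_def[symmetric] by (simp add: qpoch_of_real)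
      moreover have "of_real (qpoch (d * b) q n) = qpoch (?D * ?B) ?Q n"
        by (simp only: qpoch_of_real flip: of_real_mult)
      ultimately show ?thesis
        unfolding A An d_def[symmetric] by (simp add: mult_ac)
    qed
    finally show ?thesis using lhs by simp
  qed
  ultimately have "has_bochner_integral lborel (\<lambda>x. indicator {0<..} x *\<^sub>R
      (basic_hypergeometric [] [complex_of_real (q powr (\<alpha> + 1))] ?Q
           (- complex_of_real x * t * complex_of_real (q powr (\<alpha> + 1)))
         * complex_of_real (qlaguerre n \<beta> x q)
         * complex_of_real (x powr \<beta> / qpoch_inf (- x) q))) ?rhs"
    by (simp only:)
  then show ?thesis by (rule has_integral_of_has_bochner_integral)
qed

end
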